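(* For every real number $M>0$ there exist a finite transitive permutation group $G\leqslant \mathrm{Sym}(\Omega)$ and an intersecting set $S\subseteq G$ such that $|S|>M\,|G_\omega|$, where $G_\omega$ is the stabilizer of a point $\omega\in\Omega$.
   Context: Let $G\leqslant\mathrm{Sym}(\Omega)$ be a finite permutation group. Two elements $x,y\in G$ are said to intersect if there is a point $\alpha\in\Omega$ with $\alpha^{xy^{-1}}=\alpha$. A subset $S\subseteq G$ is an intersecting set if every pair of elements of $S$ intersect. *)

theory Defs
  imports Complex_Main "HOL-Algebra.Group_Action"
begin

text \<open>
  \<open>Sym(\<Omega>)\<close> is the library group \<^term>\<open>BijGroup \<Omega>\<close>, so a permutation group on \<open>\<Omega>\<close> is
  represented by a set \<open>G\<close> of permutations with \<^prop>\<open>subgroup G (BijGroup \<Omega>)\<close>.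
\<close>

abbreviation perm_group :: "'a set \<Rightarrow> ('a \<Rightarrow> 'a) set \<Rightarrow> ('a \<Rightarrow> 'a) monoid" where
  "perm_group \<Omega> G \<equiv> BijGroup \<Omega>\<lparr>carrier := G\<rparr>"

text \<open>
  In the exponent notation \<open>\<alpha>\<^bsup>xy\<^esup>\<close> permutations act on the right, so \<open>xy\<close> means first
  \<open>x\<close>, then \<open>y\<close>, whereas the product of \<^term>\<open>BijGroup \<Omega>\<close> is composition of functions.
  Hence the permutation written there as \<open>x y\<^bsup>-1\<^esup>\<close> is \<open>y\<^bsup>-1\<^esup> \<otimes> x\<close> in \<^term>\<open>BijGroup \<Omega>\<close>.
\<close>

definition intersect :: "'a set \<Rightarrow> ('a \<Rightarrow> 'a) \<Rightarrow> ('a \<Rightarrow> 'a) \<Rightarrow> bool" where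
  "intersect \<Omega> x y \<longleftrightarrow>
     (\<exists>\<alpha>\<in>\<Omega>. (inv\<^bsub>BijGroup \<Omega>\<^esub> y \<otimes>\<^bsub>BijGroup \<Omega>\<^esub> x) \<alpha> = \<alpha>)"

definition intersecting_set :: "'a set \<Rightarrow> ('a \<Rightarrow> 'a) set \<Rightarrow> ('a \<Rightarrow> 'a) set \<Rightarrow> bool" where
  "intersecting_set \<Omega> G S \<longleftrightarrow> S \<subseteq> G \<and> (\<forall>x\<in>S. \<forall>y\<in>S. intersect \<Omega> x y)"

end

theory Submission
  imports Defs "HOL-Algebra.Left_Coset"
begin

text \<open>
  An element fixes some coset of \<open>H\<close> iff it is conjugate into \<open>H\<close>, so for the action of a group on
  the cosets of \<open>H\<close> a subgroup whose elements are all conjugate into \<open>H\<close> is intersecting, while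
  point stabilizers are only as large as \<open>H\<close>. In the symmetric group on an elementary abelian
  2-group all nontrivial translations are conjugate, being fixed-point-free involutions, so \<open>H\<close>
  can be generated by a single translation. Here the 2-group is \<open>Pow {..k}\<close> under symmetric
  difference and \<open>H\<close> is generated by complementation; only translations by subsets of \<open>{..<k}\<close>
  are used, so that distinct ones lie in distinct cosets of \<open>H\<close> and the action need not be shown
  to be faithful.
\<close>

section \<open>Permutations of a set and intersection at a point\<close>

lemma mult_BijGroup:
  assumes "f \<in> Bij E" "g \<in> Bij E" "x \<in> E"
  shows "(f \<otimes>\<^bsub>BijGroup E\<^esub> g) x = f (g x)"
  using assms by (simp add: BijGroup_def compose_def)

lemma carrier_BijGroup [simp]: "carrier (BijGroup E) = Bij E"
  by (simp add: BijGroup_def)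

lemma BijGroup_eqI:
  assumes "f \<in> Bij E" "g \<in> Bij E" "\<And>x. x \<in> E \<Longrightarrow> f x = g x"
  shows "f = g"
  using assms by (meson Bij_imp_extensional extensionalityI)

lemma finite_Bij:
  assumes "finite E"
  shows "finite (Bij E)"
proof (rule finite_subset)
  show "Bij E \<subseteq> E \<rightarrow>\<^sub>E E"
    using Bij_imp_extensional Bij_imp_funcset unfolding PiE_def by blast
  show "finite (E \<rightarrow>\<^sub>E E)"
    using assms by (intro finite_PiE)
qed

text \<open>If \<open>x\<close> and \<open>y\<close> send \<alpha> to the same point, the inverse of
  \<open>y\<close> brings that point back to \<alpha>. Intersection is thus reduced to agreement
  somewhere, with no inverses left.\<close>

lemma intersectI:
  assumes "x \<in> Bij \<Omega>" "y \<in> Bij \<Omega>" "\<alpha> \<in> \<Omega>" "x \<alpha> = y \<alpha>"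
  shows "intersect \<Omega> x y"
proof -
  have inv_y: "inv\<^bsub>BijGroup \<Omega>\<^esub> y \<in> Bij \<Omega>"
    using group.inv_closed[OF group_BijGroup] assms(2) by fastforce
  have "(inv\<^bsub>BijGroup \<Omega>\<^esub> y \<otimes>\<^bsub>BijGroup \<Omega>\<^esub> x) \<alpha> = (inv\<^bsub>BijGroup \<Omega>\<^esub> y \<otimes>\<^bsub>BijGroup \<Omega>\<^esub> y) \<alpha>"
    using assms inv_y by (simp add: mult_BijGroup)
  also have "\<dots> = \<one>\<^bsub>BijGroup \<Omega>\<^esub> \<alpha>"
    using group.l_inv[OF group_BijGroup] assms(2) by fastforce
  also have "\<dots> = \<alpha>"
    using assms(3) by (simp add: BijGroup_def)
  finally show ?thesis
    using assms(3) unfolding intersect_def by blast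
qed

section \<open>Constructing, relabelling and projecting group actions\<close>

text \<open>Bijectivity follows from the pointwise laws, because \<open>\<phi> (inv g)\<close> is a
  two-sided inverse of \<open>\<phi> g\<close>. Extensionality is asked for because it is part of
  membership in \<open>Bij E\<close>.\<close>

lemma (in group) group_actionI:
  assumes ext: "\<And>g. g \<in> carrier G \<Longrightarrow> \<phi> g \<in> extensional E"
    and closed: "\<And>g x. g \<in> carrier G \<Longrightarrow> x \<in> E \<Longrightarrow> \<phi> g x \<in> E"
    and one: "\<And>x. x \<in> E \<Longrightarrow> \<phi> \<one> x = x"
    and mult: "\<And>g h x. g \<in> carrier G \<Longrightarrow> h \<in> carrier G \<Longrightarrow> x \<in> E \<Longrightarrow> \<phi> (g \<otimes> h) x = \<phi> g (\<phi> h x)"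
  shows "group_action G E \<phi>"
proof -
  have bij: "\<phi> g \<in> Bij E" if g: "g \<in> carrier G" for g
  proof -
    have "\<phi> (inv g) (\<phi> g x) = x" "\<phi> g (\<phi> (inv g) x) = x" if "x \<in> E" for x
      using that g mult[of "inv g" g x] mult[of g "inv g" x] by (simp_all add: one)
    then have "bij_betw (\<phi> g) E E"
      using g closed by (intro bij_betw_byWitness[where f' = "\<phi> (inv g)"]) auto
    then show ?thesis
      using ext[OF g] by (simp add: Bij_def)
  qed
  have "\<phi> \<in> hom G (BijGroup E)"
  proof (rule homI)
    fix g h
    assume gh: "g \<in> carrier G" "h \<in> carrier G"
    have "\<phi> g \<otimes>\<^bsub>BijGroup E\<^esub> \<phi> h \<in> Bij E"
      using monoid.m_closed[OF group.is_monoid[OF group_BijGroup]] bij gh by fastforce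
    then show "\<phi> (g \<otimes> h) = \<phi> g \<otimes>\<^bsub>BijGroup E\<^esub> \<phi> h"
      using gh bij by (intro BijGroup_eqI[where E = E]) (auto simp: mult_BijGroup mult)
  qed (simp add: bij)
  then show ?thesis
    by (intro group_action.intro group_hom.intro group_hom_axioms.intro group_BijGroup group_axioms)
qed

text \<open>Conjugating every \<open>\<phi> g\<close> by \<open>b\<close> respects products and
  orbits. This moves the action on cosets to a set of natural numbers, the point type in the
  theorem.\<close>

lemma (in transitive_action) relabel:
  assumes b: "bij_betw b \<Omega> E"
  shows "transitive_action G \<Omega> (\<lambda>g. \<lambda>i\<in>\<Omega>. inv_into \<Omega> b (\<phi> g (b i)))"
proof -
  interpret group G
    using group_hom by (simp add: group_hom_def)
  have bE: "b i \<in> E" if "i \<in> \<Omega>" for i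
    using bij_betwE[OF b] that by blast
  have inv_b: "inv_into \<Omega> b x \<in> \<Omega>" "b (inv_into \<Omega> b x) = x" if "x \<in> E" for x
    using b that by (metis bij_betw_def inv_into_into) (metis b that bij_betw_inv_into_right)
  have b_inv: "inv_into \<Omega> b (b i) = i" if "i \<in> \<Omega>" for i
    using b that by (rule bij_betw_inv_into_left)
  have act: "\<phi> g (b i) \<in> E" if "g \<in> carrier G" "i \<in> \<Omega>" for g i
    using element_image[OF that(1) bE[OF that(2)] refl] .
  have one: "\<phi> \<one> x = x" if "x \<in> E" for x
    using that by (simp flip: id_eq_one)
  have "group_action G \<Omega> (\<lambda>g. \<lambda>i\<in>\<Omega>. inv_into \<Omega> b (\<phi> g (b i)))"
  proof (rule group_actionI)
    fix g h i
    assume "g \<in> carrier G" "h \<in> carrier G" "i \<in> \<Omega>"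
    then show "(\<lambda>i\<in>\<Omega>. inv_into \<Omega> b (\<phi> (g \<otimes> h) (b i))) i
        = (\<lambda>i\<in>\<Omega>. inv_into \<Omega> b (\<phi> g (b i))) ((\<lambda>i\<in>\<Omega>. inv_into \<Omega> b (\<phi> h (b i))) i)"
      by (simp add: inv_b act composition_rule bE)
  qed (simp_all add: inv_b act one b_inv bE)
  moreover have "\<exists>g\<in>carrier G. (\<lambda>i\<in>\<Omega>. inv_into \<Omega> b (\<phi> g (b i))) i = j"
    if ij: "i \<in> \<Omega>" "j \<in> \<Omega>" for i j
  proof -
    obtain g where g: "g \<in> carrier G" "\<phi> g (b i) = b j"
      using unique_orbit[OF bE bE] ij by blast
    then show ?thesis
      using ij by (intro bexI[OF _ g(1)]) (simp add: b_inv)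
  qed
  ultimately show ?thesis
    by (simp add: transitive_action_def transitive_action_axioms_def)
qed

lemma (in group_action) image_subgroup: "subgroup (\<phi> ` carrier G) (BijGroup E)"
  using group_hom group_hom.img_is_subgroup by blast

text \<open>Passes from an abstract action to the permutation group it induces. That group acts by
  \<open>id\<close>, since its action homomorphism is the inclusion into
  \<open>BijGroup E\<close>.\<close>

lemma (in transitive_action) image_transitive:
  "transitive_action (perm_group E (\<phi> ` carrier G)) E id"
proof -
  have "group_action (perm_group E (\<phi> ` carrier G)) E id"
    using group.canonical_inj_is_hom[OF group_BijGroup image_subgroup]
    by (simp add: group_action_def)
  then show ?thesis
    using unique_orbit by (auto simp: transitive_action_def transitive_action_axioms_def)
qed

text \<open>Whether \<open>g\<close> fixes \<open>x\<close> depends only on \<open>\<phi> g\<close>.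
  Hence point stabilizers cannot grow when the kernel of the action is factored out.\<close>

lemma stabilizer_image:
  "stabilizer (perm_group E (\<phi> ` carrier G)) id x = \<phi> ` stabilizer G \<phi> x"
  by (auto simp: stabilizer_def)

section \<open>The action on left cosets\<close>

lemma lcosetsI: "a \<in> carrier G \<Longrightarrow> a <#\<^bsub>G\<^esub> H \<in> lcosets\<^bsub>G\<^esub> H"
  by (auto simp: LCOSETS_def)

lemma (in group) left_coset_action:
  assumes H: "subgroup H G"
  shows "transitive_action G (lcosets H) (\<lambda>g. \<lambda>C\<in>lcosets H. g <# C)"
proof -
  have HG: "H \<subseteq> carrier G"
    using H by (rule subgroup.subset)
  have closed: "g <# C \<in> lcosets H" if "g \<in> carrier G" "C \<in> lcosets H" for g C
  proof -
    obtain a where "a \<in> carrier G" "C = a <# H"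
      using \<open>C \<in> lcosets H\<close> by (auto simp: LCOSETS_def)
    then show ?thesis
      using that(1) HG lcosetsI[of "g \<otimes> a" G H] by (simp add: lcos_m_assoc)
  qed
  have sub: "C \<subseteq> carrier G" if "C \<in> lcosets H" for C
    using subgroup.lcosets_carrier[OF H group_axioms that] .
  have "group_action G (lcosets H) (\<lambda>g. \<lambda>C\<in>lcosets H. g <# C)"
    by (rule group_actionI) (simp_all add: closed sub lcos_mult_one lcos_m_assoc)
  moreover have "\<exists>g\<in>carrier G. (\<lambda>C\<in>lcosets H. g <# C) C = D"
    if CD: "C \<in> lcosets H" "D \<in> lcosets H" for C D
  proof -
    obtain c d where cd: "c \<in> carrier G" "C = c <# H" "d \<in> carrier G" "D = d <# H"
      using CD by (auto simp: LCOSETS_def)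
    have "(d \<otimes> inv c) <# C = D"
      using cd HG by (simp add: lcos_m_assoc m_assoc)
    then show ?thesis
      using CD(1) cd(1,3) by (intro bexI[of _ "d \<otimes> inv c"]) simp_all
  qed
  ultimately show ?thesis
    by (simp add: transitive_action_def transitive_action_axioms_def)
qed

text \<open>The orbit of \<open>C\<close> is the set of all cosets, so orbit-stabilizer and Lagrange
  both factor the group order with the same nonzero index, which cancels.\<close>

lemma (in group) card_stabilizer_lcoset:
  assumes fin: "finite (carrier G)" and H: "subgroup H G" and C: "C \<in> lcosets H"
  shows "card (stabilizer G (\<lambda>g. \<lambda>C\<in>lcosets H. g <# C) C) = card H"
proof -
  interpret transitive_action G "lcosets H" "\<lambda>g. \<lambda>C\<in>lcosets H. g <# C"
    using H by (rule left_coset_action)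
  have "orbit G (\<lambda>g. \<lambda>C\<in>lcosets H. g <# C) C = lcosets H"
    using C unique_orbit[of C] element_image[of _ C] unfolding orbit_def by blast
  then have "card (lcosets H) * card (stabilizer G (\<lambda>g. \<lambda>C\<in>lcosets H. g <# C) C)
      = card (lcosets H) * card H"
    using orbit_stabilizer_theorem[OF C] l_lagrange[OF fin H] by simp
  moreover have "card (lcosets H) \<noteq> 0"
    using l_lagrange[OF fin H] fin order_gt_0_iff_finite by (metis less_not_refl mult_0)
  ultimately show ?thesis
    by simp
qed

text \<open>Premise \<open>agree\<close> says that the quotient of \<open>x\<close> by
  \<open>y\<close> is conjugate into \<open>H\<close>: since \<open>h\<close> is absorbed by
  \<open>H\<close>, both elements send the coset of \<open>g\<close> to the same coset. Premise
  \<open>inj\<close> puts distinct elements of \<open>S\<close> into distinct left cosets of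
  \<open>H\<close>, so no two of them are identified by the action.\<close>

lemma (in group) intersecting_set_from_cosets:
  assumes fin: "finite (carrier G)" and H: "subgroup H G" and S: "S \<subseteq> carrier G"
    and agree: "\<And>x y. x \<in> S \<Longrightarrow> y \<in> S \<Longrightarrow> \<exists>g\<in>carrier G. \<exists>h\<in>H. x \<otimes> g = y \<otimes> (g \<otimes> h)"
    and inj: "\<And>x y h. x \<in> S \<Longrightarrow> y \<in> S \<Longrightarrow> h \<in> H \<Longrightarrow> x = y \<otimes> h \<Longrightarrow> x = y"
  obtains \<Omega> :: "nat set" and P T
  where "finite \<Omega>" "\<Omega> \<noteq> {}" "subgroup P (BijGroup \<Omega>)"
    "transitive_action (perm_group \<Omega> P) \<Omega> id" "intersecting_set \<Omega> P T" "card T = card S"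
    "\<And>\<omega>. \<omega> \<in> \<Omega> \<Longrightarrow> card (stabilizer (perm_group \<Omega> P) id \<omega>) \<le> card H"
proof -
  define E where "E = lcosets H"
  define \<phi> where "\<phi> = (\<lambda>g. \<lambda>C\<in>E. g <# C)"
  interpret coset: transitive_action G E \<phi>
    unfolding E_def \<phi>_def using H by (rule left_coset_action)
  have HG: "H \<subseteq> carrier G"
    using H by (rule subgroup.subset)
  have coset_in_E: "g <# H \<in> E" if "g \<in> carrier G" for g
    using that by (simp add: E_def lcosetsI)
  have "finite E"
    unfolding E_def LCOSETS_def using fin by simp
  then obtain b where b: "bij_betw b {0..<card E} E"
    using ex_bij_betw_nat_finite by blast
  define \<Omega> where "\<Omega> = {0..<card E}"
  define \<psi> where "\<psi> = (\<lambda>g. \<lambda>i\<in>\<Omega>. inv_into \<Omega> b (\<phi> g (b i)))"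
  have b: "bij_betw b \<Omega> E"
    using b by (simp add: \<Omega>_def)
  interpret relabelled: transitive_action G \<Omega> \<psi>
    unfolding \<psi>_def using b by (rule coset.relabel)
  have point: "\<exists>i\<in>\<Omega>. b i = g <# H" if "g \<in> carrier G" for g
    using coset_in_E[OF that] b by (metis bij_betw_imp_surj_on imageE)
  have bE: "b i \<in> E" if "i \<in> \<Omega>" for i
    using bij_betwE[OF b] that by blast
  \<comment> \<open>Relabelling is injective on cosets, so equations between labels become equations
    between cosets.\<close>
  have \<psi>_eq_iff: "\<psi> x i = \<psi> y j \<longleftrightarrow> x <# b i = y <# b j"
    if "x \<in> carrier G" "y \<in> carrier G" "i \<in> \<Omega>" "j \<in> \<Omega>" for x y i j
  proof -
    have "\<phi> x (b i) \<in> E" "\<phi> y (b j) \<in> E"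
      using that bE coset.element_image by blast+
    moreover have "inj_on (inv_into \<Omega> b) E"
      using bij_betw_inv_into[OF b] by (rule bij_betw_imp_inj_on)
    ultimately have "\<psi> x i = \<psi> y j \<longleftrightarrow> \<phi> x (b i) = \<phi> y (b j)"
      using that by (simp add: \<psi>_def inj_on_eq_iff)
    then show ?thesis
      using that bE by (simp add: \<phi>_def)
  qed
  have "\<Omega> \<noteq> {}"
    using point[OF one_closed] by blast
  moreover have "intersecting_set \<Omega> (\<psi> ` carrier G) (\<psi> ` S)"
    unfolding intersecting_set_def
  proof (intro conjI ballI image_mono S)
    fix x' y'
    assume "x' \<in> \<psi> ` S" "y' \<in> \<psi> ` S"
    then obtain x y where xy: "x \<in> S" "y \<in> S" "x' = \<psi> x" "y' = \<psi> y"
      by blast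
    then obtain g h where gh: "g \<in> carrier G" "h \<in> H" "x \<otimes> g = y \<otimes> (g \<otimes> h)"
      using agree by blast
    obtain i where i: "i \<in> \<Omega>" "b i = g <# H"
      using point gh by blast
    have carr: "x \<in> carrier G" "y \<in> carrier G" "h \<in> carrier G"
      using xy gh S HG by auto
    have "x <# (g <# H) = (y \<otimes> g \<otimes> h) <# H"
      using gh carr HG by (simp add: lcos_m_assoc m_assoc)
    also have "\<dots> = (y \<otimes> g) <# (h <# H)"
      using gh carr HG by (simp add: lcos_m_assoc)
    also have "h <# H = H"
      using l_repr_independence[of h \<one> H] gh H HG
      by (simp add: lcos_mult_one)
    also have "(y \<otimes> g) <# H = y <# (g <# H)"
      using gh carr HG by (simp add: lcos_m_assoc)
    finally have "\<psi> x i = \<psi> y i"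
      using \<psi>_eq_iff carr i by simp
    then show "intersect \<Omega> x' y'"
      using xy carr i relabelled.bij_prop0 by (auto intro: intersectI)
  qed
  moreover have "card (\<psi> ` S) = card S"
  proof (rule card_image, rule inj_onI)
    fix x y
    assume xy: "x \<in> S" "y \<in> S" "\<psi> x = \<psi> y"
    \<comment> \<open>The label of the base coset \<open>H\<close> separates \<open>S\<close>: equal
      images there put \<open>x\<close> and \<open>y\<close> in one left coset.\<close>
    obtain i where i: "i \<in> \<Omega>" "b i = H"
      using point[OF one_closed] HG by (auto simp: lcos_mult_one)
    have "x <# H = y <# H"
      using \<psi>_eq_iff[of x y i i] xy i S by auto
    then have "x \<in> y <# H"
      using lcos_self[OF _ H, of x] xy S by auto
    then show "x = y"
      using inj xy by (auto simp: l_coset_def)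
  qed
  moreover have "card (stabilizer (perm_group \<Omega> (\<psi> ` carrier G)) id \<omega>) \<le> card H"
    if \<omega>: "\<omega> \<in> \<Omega>" for \<omega>
  proof -
    have "stabilizer G \<psi> \<omega> \<subseteq> stabilizer G \<phi> (b \<omega>)"
    proof
      fix g
      assume g: "g \<in> stabilizer G \<psi> \<omega>"
      \<comment> \<open>Fixing \<omega> is rephrased as agreeing there with the identity element, so
        that \<open>\<psi>_eq_iff\<close> applies.\<close>
      then have "\<psi> g \<omega> = \<psi> \<one> \<omega>"
        using \<omega> by (simp add: stabilizer_def flip: relabelled.id_eq_one)
      then have "g <# b \<omega> = \<one> <# b \<omega>"
        using \<psi>_eq_iff[of g \<one> \<omega> \<omega>] g \<omega> by (simp add: stabilizer_def)
      also have "\<dots> = \<phi> \<one> (b \<omega>)"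
        using bE[OF \<omega>] by (simp add: \<phi>_def)
      also have "\<dots> = b \<omega>"
        using bE[OF \<omega>] by (simp flip: coset.id_eq_one)
      finally show "g \<in> stabilizer G \<phi> (b \<omega>)"
        using g bE[OF \<omega>] by (simp add: stabilizer_def \<phi>_def)
    qed
    moreover have "finite (stabilizer G \<phi> (b \<omega>))"
      using fin coset.stabilizer_subset finite_subset by blast
    \<comment> \<open>Only an inequality, as \<psi> may have a kernel that collapses elements of the
      stabilizer.\<close>
    ultimately have "card (\<psi> ` stabilizer G \<psi> \<omega>) \<le> card (stabilizer G \<phi> (b \<omega>))"
      by (meson card_image_le card_mono finite_subset le_trans)
    then show ?thesis
      using card_stabilizer_lcoset[OF fin H, of "b \<omega>"] bE[OF \<omega>]
      by (simp add: stabilizer_image E_def \<phi>_def)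
  qed
  ultimately show thesis
    using that[of \<Omega> "\<psi> ` carrier G" "\<psi> ` S"] relabelled.image_subgroup relabelled.image_transitive
    by (simp add: \<Omega>_def)
qed

section \<open>Involutions and translations of a power set\<close>

lemma (in group) subgroup_involution:
  assumes "t \<in> carrier G" "t \<otimes> t = \<one>"
  shows "subgroup {\<one>, t} G"
  using assms by (intro subgroupI) (auto simp: inv_equality)

text \<open>Restricted to \<open>Pow K\<close> so that it is extensional, as
  \<open>Bij (Pow K)\<close> demands.\<close>

definition translation :: "'a set \<Rightarrow> 'a set \<Rightarrow> 'a set \<Rightarrow> 'a set" where
  "translation K c = (\<lambda>x\<in>Pow K. sym_diff x c)"

lemma involution_in_Bij:
  assumes "f \<in> extensional E" "\<And>x. x \<in> E \<Longrightarrow> f x \<in> E" "\<And>x. x \<in> E \<Longrightarrow> f (f x) = x"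
  shows "f \<in> Bij E"
proof -
  have "bij_betw f E E"
    using assms by (intro bij_betw_byWitness[where f' = f]) auto
  then show ?thesis
    using assms(1) by (simp add: Bij_def)
qed

lemma translation_in_Bij: "c \<subseteq> K \<Longrightarrow> translation K c \<in> Bij (Pow K)"
  unfolding translation_def by (rule involution_in_Bij) auto

lemma inj_on_translation: "inj_on (translation K) (Pow K)"
proof (rule inj_onI)
  fix c d
  assume "translation K c = translation K d"
  \<comment> \<open>The empty set is the zero element, so its image under a translation is the
    translating set.\<close>
  then have "translation K c {} = translation K d {}"
    by simp
  then show "c = d"
    by (simp add: translation_def)
qed

text \<open>If \<open>i \<in> c\<close>, the flip of the sets containing \<open>i\<close> by \<open>K - c\<close> is an involution that
  conjugates complementation into translation by \<open>c\<close>.\<close>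

lemma translation_conjugate:
  assumes c: "c \<subseteq> K" "c \<noteq> {}"
  shows "\<exists>g\<in>Bij (Pow K). \<forall>x\<in>Pow K. sym_diff (g x) c = g (sym_diff x K)"
proof -
  obtain i where i: "i \<in> c"
    using c by blast
  define g where "g = (\<lambda>x\<in>Pow K. if i \<in> x then sym_diff x (K - c) else x)"
  have "g \<in> Bij (Pow K)"
    unfolding g_def by (rule involution_in_Bij) (use c i in auto)
  \<comment> \<open>Exactly one of \<open>x\<close> and its complement contains \<open>i\<close>, so
    exactly one side of the equation is flipped by \<open>K - c\<close>. This flip is the difference
    between translating by \<open>c\<close> and by \<open>K\<close>.\<close>
  moreover have "sym_diff (g x) c = g (sym_diff x K)" if "x \<in> Pow K" for x
    using that c i by (auto simp: g_def)
  ultimately show ?thesis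
    by blast
qed

section \<open>Choice of the parameters and assembly\<close>

theorem theorem1p1:
  fixes M :: real
  assumes "M > 0"
  shows "\<exists>(\<Omega> :: nat set) G S.
           finite \<Omega> \<and> \<Omega> \<noteq> {} \<and>
           subgroup G (BijGroup \<Omega>) \<and>
           transitive_action (perm_group \<Omega> G) \<Omega> id \<and>
           intersecting_set \<Omega> G S \<and>
           (\<forall>\<omega>\<in>\<Omega>. real (card S) > M * real (card (stabilizer (perm_group \<Omega> G) id \<omega>)))"
proof -
  \<comment> \<open>The factor 2 bounds the order of the subgroup generated by \<open>t\<close>, and
    \<open>2 ^ k\<close> will be the size of \<open>S\<close>.\<close>
  obtain k :: nat where k: "2 * M < 2 ^ k"
    using real_arch_pow[of 2 "2 * M"] by auto
  define K where "K = {..k}"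
  define t where "t = translation K K"
  define A where "A = BijGroup (Pow K)"
  define S where "S = translation K ` Pow {..<k}"
  interpret group A
    unfolding A_def by (rule group_BijGroup)
  have carrier: "carrier A = Bij (Pow K)"
    by (simp add: A_def)
  have mult: "(f \<otimes>\<^bsub>A\<^esub> g) x = f (g x)" if "f \<in> carrier A" "g \<in> carrier A" "x \<in> Pow K" for f g x
    using that by (simp add: A_def mult_BijGroup)
  have one: "\<one>\<^bsub>A\<^esub> x = x" if "x \<in> Pow K" for x
    using that by (simp add: A_def BijGroup_def)
  have eqI: "f = g" if "f \<in> carrier A" "g \<in> carrier A" "\<And>x. x \<in> Pow K \<Longrightarrow> f x = g x" for f g
    using that BijGroup_eqI unfolding carrier by blast
  have translation: "translation K c \<in> carrier A" if "c \<subseteq> K" for c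
    using that translation_in_Bij unfolding carrier by blast
  have t: "t \<in> carrier A"
    by (simp add: t_def translation)
  have t_apply: "t x = K - x" if "x \<in> Pow K" for x
    using that by (auto simp: t_def translation_def)
  have "t \<otimes>\<^bsub>A\<^esub> t = \<one>\<^bsub>A\<^esub>"
    by (rule eqI) (simp_all add: t mult one t_apply double_diff)
  then have H: "subgroup {\<one>\<^bsub>A\<^esub>, t} A"
    using t by (rule subgroup_involution[rotated])
  have "{..<k} \<subseteq> K"
    by (auto simp: K_def)
  then have S: "S \<subseteq> carrier A"
    unfolding S_def using translation by blast
  have fin: "finite (carrier A)"
    unfolding carrier by (simp add: K_def finite_Bij)
  have agree: "\<exists>g\<in>carrier A. \<exists>h\<in>{\<one>\<^bsub>A\<^esub>, t}. x \<otimes>\<^bsub>A\<^esub> g = y \<otimes>\<^bsub>A\<^esub> (g \<otimes>\<^bsub>A\<^esub> h)"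
    if xy: "x \<in> S" "y \<in> S" for x y
  \<comment> \<open>Equal elements agree everywhere, so \<open>h\<close> is the identity. They are
    split off because \<open>translation_conjugate\<close> requires a nonempty translating
    set.\<close>
  proof (cases "x = y")
    case True
    then show ?thesis
      using xy S by (intro bexI[of _ "\<one>\<^bsub>A\<^esub>"]) auto
  next
    case False
    obtain c d where cd: "c \<subseteq> K" "d \<subseteq> K" "x = translation K c" "y = translation K d"
      using xy \<open>{..<k} \<subseteq> K\<close> unfolding S_def by blast
    \<comment> \<open>The quotient of \<open>x\<close> by \<open>y\<close> is translation by
      \<open>sym_diff c d\<close>, which some \<open>g\<close> conjugates to complementation
      \<open>t\<close>.\<close>
    then have "sym_diff c d \<subseteq> K" "sym_diff c d \<noteq> {}"
      using False by auto
    then obtain g where g: "g \<in> carrier A"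
      and conj: "\<And>z. z \<in> Pow K \<Longrightarrow> sym_diff (g z) (sym_diff c d) = g (sym_diff z K)"
      using translation_conjugate unfolding carrier by meson
    have "x \<otimes>\<^bsub>A\<^esub> g = y \<otimes>\<^bsub>A\<^esub> (g \<otimes>\<^bsub>A\<^esub> t)"
    proof (rule eqI)
      fix z
      assume z: "z \<in> Pow K"
      have gz: "g z \<in> Pow K" "g (sym_diff z K) \<in> Pow K"
        using g z unfolding carrier by (auto dest!: Bij_imp_funcset)
      have "(x \<otimes>\<^bsub>A\<^esub> g) z = sym_diff (g z) c"
        using g z gz cd translation by (simp add: mult translation_def)
      \<comment> \<open>Translation by \<open>c\<close> is split into translation by
        \<open>sym_diff c d\<close> followed by translation by \<open>d\<close>; the first is then
        traded for \<open>t\<close> inside \<open>g\<close>.\<close>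
      also have "\<dots> = sym_diff (sym_diff (g z) (sym_diff c d)) d"
        by blast
      also have "\<dots> = sym_diff (g (sym_diff z K)) d"
        using conj[OF z] by simp
      also have "\<dots> = (y \<otimes>\<^bsub>A\<^esub> (g \<otimes>\<^bsub>A\<^esub> t)) z"
        using g z gz cd t translation by (simp add: mult translation_def t_def)
      finally show "(x \<otimes>\<^bsub>A\<^esub> g) z = (y \<otimes>\<^bsub>A\<^esub> (g \<otimes>\<^bsub>A\<^esub> t)) z" .
    qed (use cd g t translation in auto)
    then show ?thesis
      using g by blast
  qed
  have inj: "x = y" if xy: "x \<in> S" "y \<in> S" and h: "h \<in> {\<one>\<^bsub>A\<^esub>, t}" "x = y \<otimes>\<^bsub>A\<^esub> h" for x y h
  proof (cases "h = t")
    case True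
    obtain c d where cd: "c \<subseteq> {..<k}" "d \<subseteq> {..<k}" "x = translation K c" "y = translation K d"
      using xy by (auto simp: S_def)
    have "(y \<otimes>\<^bsub>A\<^esub> t) {} = sym_diff K d"
      using xy S t cd by (subst mult) (auto simp: t_def translation_def)
    moreover have "x {} = c"
      using cd by (simp add: translation_def)
    ultimately have "c = sym_diff K d"
      using h True by simp
    \<comment> \<open>Contradiction at the extra point \<open>k\<close> of \<open>K\<close>: it lies
      in the complement of \<open>d\<close> but not in \<open>c\<close>.\<close>
    then show ?thesis
      using cd by (auto simp: K_def)
  next
    case False
    then show ?thesis
      using xy h S by auto
  qed
  obtain \<Omega> :: "nat set" and P T where PT: "finite \<Omega>" "\<Omega> \<noteq> {}" "subgroup P (BijGroup \<Omega>)"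
    "transitive_action (perm_group \<Omega> P) \<Omega> id" "intersecting_set \<Omega> P T" "card T = card S"
    "\<And>\<omega>. \<omega> \<in> \<Omega> \<Longrightarrow> card (stabilizer (perm_group \<Omega> P) id \<omega>) \<le> card {\<one>\<^bsub>A\<^esub>, t}"
    by (rule intersecting_set_from_cosets[OF fin H S agree inj]) (assumption | rule that)+
  have "card S = card (Pow {..<k})"
    unfolding S_def
    using \<open>{..<k} \<subseteq> K\<close> by (intro card_image inj_on_subset[OF inj_on_translation] Pow_mono)
  then have "card T = 2 ^ k"
    using PT by (simp add: card_Pow)
  moreover have "M * real (card (stabilizer (perm_group \<Omega> P) id \<omega>)) < 2 ^ k" if "\<omega> \<in> \<Omega>" for \<omega>
  proof -
    have "card {\<one>\<^bsub>A\<^esub>, t} \<le> 2"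
      using card_insert_le_m1[of 2 "{t}"] by simp
    then have "real (card (stabilizer (perm_group \<Omega> P) id \<omega>)) \<le> 2"
      using PT(7)[OF that] by linarith
    then have "M * real (card (stabilizer (perm_group \<Omega> P) id \<omega>)) \<le> M * 2"
      using assms by (intro mult_left_mono) auto
    then show ?thesis
      using k by linarith
  qed
  ultimately show ?thesis
    using PT by (intro exI[of _ \<Omega>] exI[of _ P] exI[of _ T]) auto
qed

end
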